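(* Let $f:\mathbb{R}^d\to\mathbb{R}$ be differentiable and $L$-smooth, i.e. $\|\nabla f(x)-\nabla f(y)\|\le L\|x-y\|$ for all $x,y$, and bounded below by $f^*\in\mathbb{R}$. Let every one of the $n$ workers be able to compute stochastic gradients $\nabla f(x;\xi)$, $\xi\sim\mathcal{D}$, with $\mathbb{E}_\xi[\nabla f(x;\xi)]=\nabla f(x)$ and $\mathbb{E}_\xi[\|\nabla f(x;\xi)-\nabla f(x)\|^2]\le\sigma^2$ for all $x\in\mathbb{R}^d$, where $\sigma^2\ge0$. Let the computation powers $v_1,\dots,v_n:\mathbb{R}_+\to\mathbb{R}_+$ be non-negative and continuous almost everywhere, with $V_i(t)=\int_0^t v_i(\tau)d\tau$. Let $\varepsilon>0$, let $x^0\in\mathbb{R}^d$ be the starting point and $\Delta:=f(x^0)-f^*$. Run Rennala SGD with stepsize $\gamma=1/(2L)$ and batch size $S=\max\{\lceil\sigma^2/\varepsilon\rceil,1\}$. Define $\bar t_0=0$ and, for all $k\ge1$, $$\bar t_k:=\min\Big\{t\ge0:\sum_{i=1}^n\lfloor V_i(t)-V_i(\bar t_{k-1})\rfloor\ge\max\big\{\lceil\sigma^2/\varepsilon\rceil,1\big\}\Big\}.$$ Then Rennala SGD converges after at most $\bar t_{\lceil 24L\Delta/\varepsilon\rceil}$ seconds; that is, with $K=\lceil 24L\Delta/\varepsilon\rceil$, the first $K$ iterations of the method are completed by time $\bar t_K$, and (if $K\ge1$) the iterates satisfy $\frac1K\sum_{k=0}^{K-1}\mathbb{E}[\|\nabla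 f(x^k)\|^2]\le\varepsilon$.
   Context: Notation: $\mathbb{R}_+=[0,\infty)$; $\min\emptyset=\infty$, and $\bar t_k=\infty$ if $\bar t_{k-1}=\infty$. Computation model: $n$ workers compute in parallel, time starts at $0$, and communication and server updates take no time. $V_i$ (Riemann integral) is finite, continuous and non-decreasing on $\mathbb{R}_+$. If worker $i$ starts computing at time $t_0$ and works without being stopped (starting a new stochastic gradient as soon as the previous one is finished), then by time $t_1\ge t_0$ it has finished $\lfloor V_i(t_1)-V_i(t_0)\rfloor$ stochastic gradients. Stopping a worker discards its unfinished computation. The computation powers are independent of the stochastic gradient noise. Rennala SGD (input: $x^0$, stepsize $\gamma$, batch size $S$): for $k=0,1,\dots$: the server asks all workers to compute stochastic gradients at $x^k$; whenever a worker finishes a stochastic gradient at $x^k$ the server receives it and the worker is asked to compute another stochastic gradient at $x^k$; as soon as $S$ stochastic gradients $\nabla f(x^k;\xi^k_1),\dots,\nabla f(x^k;\xi^k_S)$ (with i.i.d. samples $\xi^k_s\sim\mathcal{D}$) in total have been received, the server sets $g^k=\frac1S\sum_{s=1}^S\nabla f(x^k;\xi^k_s)$, $x^{k+1}=x^k-\gamma g^k$, stops all the workers' computations, and goes to the next iteration. *)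

theory Defs
  imports "HOL-Probability.Probability"
begin

section \<open>Computation dynamics\<close>

text \<open>The Henstock--Kurzweil integral, which agrees with the Riemann integral whenever the latter
  exists. Computation powers are only ever evaluated on the half-line of non-negative times.\<close>

definition work :: "(real \<Rightarrow> real) \<Rightarrow> real \<Rightarrow> real"
  where "work v t = integral {0..t} v"

definition num_finished :: "(real \<Rightarrow> real) \<Rightarrow> real \<Rightarrow> real \<Rightarrow> int"
  where "num_finished v t0 t1 = \<lfloor>work v t1 - work v t0\<rfloor>"

text \<open>The time at which a worker that starts at \<open>t0\<close> and is not stopped has finished its \<open>j\<close>-th
  stochastic gradient (\<open>j \<ge> 1\<close>); it is \<open>\<infinity>\<close> if this never happens, since \<open>Inf {} = \<infinity>\<close> in \<^typ>\<open>ereal\<close>.\<close>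

definition finish_time :: "(real \<Rightarrow> real) \<Rightarrow> real \<Rightarrow> nat \<Rightarrow> ereal"
  where "finish_time v t0 j = Inf (ereal ` {t. t0 \<le> t \<and> int j \<le> num_finished v t0 t})"

text \<open>The sequence of upper bounds. By continuity of \<^term>\<open>work (v i)\<close> the set is closed, so the
  infimum is a minimum whenever the set is non-empty; \<open>Inf {} = \<infinity>\<close> is the convention
  \<open>min {} = \<infinity>\<close>. Here \<open>t\<close> ranges over all non-negative times, also those before the previous
  bound (where the floors are non-positive integers).\<close>

primrec tbar :: "nat \<Rightarrow> (nat \<Rightarrow> real \<Rightarrow> real) \<Rightarrow> nat \<Rightarrow> nat \<Rightarrow> ereal" where
  "tbar n v S 0 = 0"
| "tbar n v S (Suc k) =
     (if tbar n v S k = \<infinity> then \<infinity>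
      else Inf (ereal ` {t. 0 \<le> t \<and>
             int S \<le> (\<Sum>i<n. \<lfloor>work (v i) t - work (v i) (real_of_ereal (tbar n v S k))\<rfloor>)}))"


section \<open>Rennala SGD\<close>

text \<open>Timing of a run. \<open>T k\<close> is the time at which iteration \<open>k\<close> starts, i.e. at which iterations
  \<open>0, \<dots>, k - 1\<close> are completed. In iteration \<open>k\<close> all workers start from scratch at time \<open>T k\<close>, and
  \<open>a k s = (i, j)\<close> says that the \<open>s\<close>-th stochastic gradient received by the server
  (\<open>1 \<le> s \<le> S\<close>) is the \<open>j\<close>-th one that worker \<open>i\<close> computes in this iteration. Gradients are received
  in the order in which they are finished, with arbitrary tie-breaking, and the iteration ends as
  soon as the \<open>S\<close>-th one has arrived. If the workers never finish \<open>S\<close> gradients in total, then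
  \<open>a k S\<close> is a computation with \<open>finish_time\<close> \<open>\<infinity>\<close>, and iteration \<open>k\<close> never ends.\<close>

definition rennala_timing ::
  "nat \<Rightarrow> (nat \<Rightarrow> real \<Rightarrow> real) \<Rightarrow> nat \<Rightarrow> (nat \<Rightarrow> nat \<Rightarrow> nat \<times> nat) \<Rightarrow> (nat \<Rightarrow> ereal) \<Rightarrow> bool"
  where "rennala_timing n v S a T \<longleftrightarrow>
    T 0 = 0 \<and>
    (\<forall>k. T k = \<infinity> \<longrightarrow> T (Suc k) = \<infinity>) \<and>
    (\<forall>k. T k \<noteq> \<infinity> \<longrightarrow>
      (let fin = (\<lambda>(i, j). finish_time (v i) (real_of_ereal (T k)) j);
           computations = {..<n} \<times> {1..}
       in inj_on (a k) {1..S} \<and> a k ` {1..S} \<subseteq> computations \<and>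
          (\<forall>s\<in>{1..S}. \<forall>s'\<in>{1..S}. s \<le> s' \<longrightarrow> fin (a k s) \<le> fin (a k s')) \<and>
          (\<forall>p\<in>computations - a k ` {1..S}. fin (a k S) \<le> fin p) \<and>
          T (Suc k) = fin (a k S)))"

text \<open>Iterates of a run, where \<open>\<xi> k s\<close> is the sample used by the \<open>s\<close>-th stochastic gradient that the
  server receives in iteration \<open>k\<close>. The recursion makes sense for all \<open>k\<close>; if iteration \<open>k\<close> is never
  completed, then the later values are those which the method would produce.\<close>

primrec rennala_iterate ::
  "('x::real_vector \<Rightarrow> 'z \<Rightarrow> 'x) \<Rightarrow> real \<Rightarrow> nat \<Rightarrow> 'x \<Rightarrow> (nat \<Rightarrow> nat \<Rightarrow> 'w \<Rightarrow> 'z) \<Rightarrow> nat \<Rightarrow> 'w \<Rightarrow> 'x" where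
  "rennala_iterate G \<gamma> S x0 \<xi> 0 \<omega> = x0"
| "rennala_iterate G \<gamma> S x0 \<xi> (Suc k) \<omega> =
     (let x = rennala_iterate G \<gamma> S x0 \<xi> k \<omega>;
          g = (1 / real S) *\<^sub>R (\<Sum>s\<in>{1..S}. G x (\<xi> k s \<omega>))
      in x - \<gamma> *\<^sub>R g)"

end

theory Submission
  imports Defs
begin

text \<open>
  The theorem joins two statements that do not interact: the times at which iterations end are
  determined by the computation powers alone, and the quality of the iterates depends only on the
  number of iterations.

  \<^emph>\<open>Time.\<close> The bounds \<^const>\<open>tbar\<close> dominate the true iteration times by induction on the
  iteration (\<open>rennala_time_le_tbar\<close>). If an iteration starts no later than its bound, then, since
  accumulated work is monotone, at every later time \<open>t\<close> each worker has finished at least as many gradients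
  as the floor in the definition of the next bound credits to it. If these floors add up to \<open>S\<close>,
  at least \<open>S\<close> computations are finished by time \<open>t\<close>; the server takes them in the order in which
  they finish, so by pigeonhole its \<open>S\<close>-th one has arrived (\<open>batch_complete_by\<close>).

  \<^emph>\<open>Accuracy.\<close> With \<open>x\<close> the current iterate and \<open>e\<close> the average noise of a batch, the new iterate is
  \<open>x - (gradf x + e) / (2 L)\<close>. Smoothness of \<open>f\<close> bounds the change of \<open>f\<close> by
  \<open>- 3/(8 L) |gradf x|^2 - 1/(4 L) <gradf x, e> + 1/(8 L) |e|^2\<close> (\<open>descent_step\<close>).
  A sample of the current batch is independent of the iterate and of the other samples of the
  batch, so its noise has mean zero given all of these (\<open>noise_orthogonal\<close>). Hence the mixed term
  has expectation zero, and the noises in a batch are pairwise orthogonal, which gives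
  \<open>E |e|^2 \<le> \<sigma>^2 / S\<close> (\<open>batch_noise_second_moment\<close>). The expected decreases telescope, and \<open>f\<close> cannot
  fall below \<open>fstar\<close>, so the mean of \<open>E |gradf (x k)|^2\<close> over \<open>K\<close> iterations is at most
  \<open>8 L (f x0 - fstar) / (3 K) + \<sigma>^2 / (3 S)\<close> (\<open>average_gradient_sq_le\<close>). For the prescribed \<open>K\<close> and \<open>S\<close>
  this is at most \<open>\<epsilon>/9 + \<epsilon>/3\<close>.
\<close>

section \<open>Iteration times\<close>

lemma work_mono:
  assumes nonneg: "\<And>t. 0 \<le> t \<Longrightarrow> 0 \<le> v t"
    and integrable: "\<And>t. 0 \<le> t \<Longrightarrow> v integrable_on {0..t}"
    and "0 \<le> s" "s \<le> t"
  shows "work v s \<le> work v t"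
  unfolding work_def using assms by (intro integral_subset_le) auto

lemma finish_time_ge: "ereal t0 \<le> finish_time v t0 j"
  unfolding finish_time_def by (rule Inf_greatest) auto

lemma finish_time_le:
  assumes "t0 \<le> t" "int j \<le> num_finished v t0 t"
  shows "finish_time v t0 j \<le> ereal t"
  unfolding finish_time_def using assms by (intro Inf_lower) auto

text \<open>
  The pigeonhole argument. Here \<open>q i\<close> is a lower bound on the number of gradients that worker \<open>i\<close>
  has finished by time \<open>t\<close>, and \<open>c\<close> lists the computations that make up the batch. The finished
  computations number at least \<open>S\<close>, so they cannot all be among the \<open>S - 1\<close> members of the batch other
  than \<open>c S\<close>: either \<open>c S\<close> itself is finished, or some computation outside the batch is, and \<open>c S\<close> finishes
  no later than that one.
\<close>

lemma batch_complete_by: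
  fixes fin :: "nat \<times> nat \<Rightarrow> ereal" and q :: "nat \<Rightarrow> int"
  assumes inj: "inj_on c {1..S}" and "S \<ge> 1"
    and first: "\<And>p. p \<in> {..<n} \<times> {1..} - c ` {1..S} \<Longrightarrow> fin (c S) \<le> fin p"
    and finished: "\<And>i j. i < n \<Longrightarrow> 1 \<le> j \<Longrightarrow> int j \<le> q i \<Longrightarrow> fin (i, j) \<le> t"
    and count: "int S \<le> (\<Sum>i<n. q i)"
  shows "fin (c S) \<le> t"
proof -
  define P where "P = (SIGMA i:{..<n}. {1..nat (q i)})"
  have finP: "fin p \<le> t" and P_sub: "p \<in> {..<n} \<times> {1..}" if "p \<in> P" for p
    using that finished by (auto simp: P_def)
  \<comment> \<open>A negative \<open>q i\<close> contributes no computation; replacing it by zero only enlarges the sum.\<close>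
  have "int S \<le> (\<Sum>i<n. int (nat (q i)))"
    using count by (rule order_trans) (intro sum_mono, auto)
  also have "\<dots> = int (card P)"
    by (simp add: P_def)
  finally have card_P: "S \<le> card P" by simp
  have "\<not> P \<subseteq> c ` {1..S} - {c S}"
  proof
    assume "P \<subseteq> c ` {1..S} - {c S}"
    then have "card P \<le> card (c ` {1..S} - {c S})"
      by (intro card_mono) auto
    also have "\<dots> < card (c ` {1..S})"
      using \<open>S \<ge> 1\<close> by (intro psubset_card_mono) auto
    also have "\<dots> = S"
      using inj by (simp add: card_image)
    finally show False using card_P by simp
  qed
  then obtain p where "p \<in> P" "p = c S \<or> p \<notin> c ` {1..S}"
    by blast
  then show ?thesis
    using finP[of p] P_sub[of p] first[of p] by (metis DiffI order_trans)
qed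

text \<open>
  Starting an iteration earlier than its bound only helps: for \<open>T k \<le> tbar n v S k\<close>, every time that competes
  in the infimum defining the next bound is a time by which iteration \<open>k\<close> is complete. The lower
  bound \<open>0 \<le> T k\<close> belongs to the induction because it excludes \<open>- \<infinity>\<close>, so that a start time other than \<open>\<infinity>\<close> is
  a real number from which work can be counted.
\<close>

theorem rennala_time_le_tbar:
  assumes nonneg: "\<And>i t. i < n \<Longrightarrow> 0 \<le> t \<Longrightarrow> 0 \<le> v i t"
    and integrable: "\<And>i t. i < n \<Longrightarrow> 0 \<le> t \<Longrightarrow> v i integrable_on {0..t}"
    and timing: "rennala_timing n v S a T"
    and "S \<ge> 1"
  shows "0 \<le> T k \<and> T k \<le> tbar n v S k"
proof (induction k)
  case 0
  then show ?case using timing by (simp add: rennala_timing_def)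
next
  case (Suc k)
  have mono: "work (v i) s \<le> work (v i) t" if "i < n" "0 \<le> s" "s \<le> t" for i s t
    using that nonneg integrable by (intro work_mono) auto
  show ?case
  proof (cases "T k = \<infinity>")
    case True
    then show ?thesis using Suc timing by (simp add: rennala_timing_def)
  next
    case False
    define r where "r = real_of_ereal (T k)"
    have T_k: "T k = ereal r" and "0 \<le> r"
      using Suc False by (cases "T k"; simp add: r_def)+
    define fin where "fin = (\<lambda>(i, j). finish_time (v i) r j)"
    have inj: "inj_on (a k) {1..S}"
      and first: "\<And>p. p \<in> {..<n} \<times> {1..} - a k ` {1..S} \<Longrightarrow> fin (a k S) \<le> fin p"
      and T_Suc: "T (Suc k) = fin (a k S)"
      using timing False unfolding rennala_timing_def fin_def r_def Let_def by blast+
    have "0 \<le> T (Suc k)"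
      using finish_time_ge[of r] \<open>0 \<le> r\<close>
      by (auto simp: T_Suc fin_def split: prod.split intro: order_trans[of 0 "ereal r"])
    moreover have "T (Suc k) \<le> tbar n v S (Suc k)"
    proof (cases "tbar n v S k = \<infinity>")
      case False
      define b where "b = real_of_ereal (tbar n v S k)"
      have "r \<le> b"
        using Suc False T_k by (cases "tbar n v S k"; simp add: b_def)
      have "fin (a k S) \<le> ereal t"
        if "0 \<le> t" and count: "int S \<le> (\<Sum>i<n. \<lfloor>work (v i) t - work (v i) b\<rfloor>)" for t
      proof -
        \<comment> \<open>Competing times before \<open>r\<close> are excluded since there all floors are non-positive.\<close>
        have "r \<le> t"
        proof (rule ccontr)
          assume "\<not> r \<le> t"
          with \<open>r \<le> b\<close> \<open>0 \<le> t\<close> mono have "(\<Sum>i<n. \<lfloor>work (v i) t - work (v i) b\<rfloor>) \<le> 0"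
            by (intro sum_nonpos) (simp add: floor_le_iff le_less_trans[OF _ zero_less_one])
          with count \<open>S \<ge> 1\<close> show False by simp
        qed
        have "int S \<le> (\<Sum>i<n. num_finished (v i) r t)"
          using count
        proof (rule order_trans)
          show "(\<Sum>i<n. \<lfloor>work (v i) t - work (v i) b\<rfloor>) \<le> (\<Sum>i<n. num_finished (v i) r t)"
            unfolding num_finished_def using mono \<open>0 \<le> r\<close> \<open>r \<le> b\<close>
            by (intro sum_mono floor_mono) simp
        qed
        then show ?thesis
          by (rule batch_complete_by[where fin = fin, OF inj \<open>S \<ge> 1\<close> first, rotated 2])
            (use \<open>r \<le> t\<close> in \<open>auto simp: fin_def intro: finish_time_le\<close>)
      qed
      then show ?thesis
        using False by (auto simp: T_Suc b_def intro!: Inf_greatest)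
    qed simp
    ultimately show ?thesis by simp
  qed
qed

section \<open>Descent for smooth functions\<close>

locale smooth_function =
  fixes f :: "'a::euclidean_space \<Rightarrow> real" and gradf :: "'a \<Rightarrow> 'a" and L fstar :: real
  assumes gradient: "GDERIV f x :> gradf x"
    and L_pos: "L > 0"
    and gradient_Lipschitz: "norm (gradf x - gradf y) \<le> L * norm (x - y)"
    and bounded_below: "fstar \<le> f x"
begin

text \<open>
  Along the segment from \<open>x\<close> to \<open>x + h\<close>, the difference \<open>\<phi>\<close> between \<open>f\<close> and the quadratic model has a
  non-positive derivative, because the gradient moves by at most \<open>L t |h|\<close>.
\<close>

lemma quadratic_upper_bound: "f (x + h) \<le> f x + gradf x \<bullet> h + L / 2 * (norm h)\<^sup>2"
proof -
  define \<phi> where "\<phi> = (\<lambda>t. f (x + t *\<^sub>R h) - t * (gradf x \<bullet> h) - L / 2 * (norm h)\<^sup>2 * t\<^sup>2)"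
  have "\<phi> 1 \<le> \<phi> 0"
  proof (rule DERIV_nonpos_imp_nonincreasing[of 0 1 \<phi>])
    fix t :: real assume "0 \<le> t" "t \<le> 1"
    have f': "(f has_derivative (\<lambda>k. k \<bullet> gradf (x + t *\<^sub>R h))) (at (x + t *\<^sub>R h))"
      using gradient by (simp add: gderiv_def)
    have "((\<lambda>t. f (x + t *\<^sub>R h)) has_derivative
        (\<lambda>s. (s *\<^sub>R h) \<bullet> gradf (x + t *\<^sub>R h))) (at t)"
      by (rule has_derivative_compose[where f = "\<lambda>t. x + t *\<^sub>R h" and g = f, OF _ f'])
        (auto intro!: derivative_eq_intros)
    then have "((\<lambda>t. f (x + t *\<^sub>R h)) has_real_derivative h \<bullet> gradf (x + t *\<^sub>R h)) (at t)"
      by (simp add: has_field_derivative_def mult_commute_abs)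
    then have "(\<phi> has_real_derivative
        h \<bullet> gradf (x + t *\<^sub>R h) - gradf x \<bullet> h - L * (norm h)\<^sup>2 * t) (at t)"
      unfolding \<phi>_def by (auto intro!: derivative_eq_intros)
    moreover have "h \<bullet> gradf (x + t *\<^sub>R h) - gradf x \<bullet> h \<le> L * (norm h)\<^sup>2 * t"
    proof -
      have "h \<bullet> gradf (x + t *\<^sub>R h) - gradf x \<bullet> h = h \<bullet> (gradf (x + t *\<^sub>R h) - gradf x)"
        by (simp add: inner_diff_right inner_commute)
      also have "\<dots> \<le> norm h * norm (gradf (x + t *\<^sub>R h) - gradf x)"
        by (rule norm_cauchy_schwarz)
      also have "\<dots> \<le> norm h * (L * norm (t *\<^sub>R h))"
        using gradient_Lipschitz[of "x + t *\<^sub>R h" x] by (intro mult_left_mono) auto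
      finally show ?thesis
        using \<open>0 \<le> t\<close> by (simp add: power2_eq_square mult_ac)
    qed
    ultimately show "\<exists>y. (\<phi> has_real_derivative y) (at t) \<and> y \<le> 0"
      by (intro exI conjI) auto
  qed simp
  then show ?thesis by (simp add: \<phi>_def)
qed

text \<open>
  A step \<open>-gradf x / L\<close>, which minimises the quadratic model, must not take \<open>f\<close> below \<open>fstar\<close>. This makes the
  squared gradient integrable along the iterates as soon as \<open>f\<close> is, so that no moments of the iterates
  themselves have to be controlled.
\<close>

lemma norm_gradient_sq_le: "(norm (gradf x))\<^sup>2 \<le> 2 * L * (f x - fstar)"
proof -
  have "fstar \<le> f (x + (- 1 / L) *\<^sub>R gradf x)"
    by (rule bounded_below)
  also have "\<dots> \<le> f x + gradf x \<bullet> ((- 1 / L) *\<^sub>R gradf x)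
      + L / 2 * (norm ((- 1 / L) *\<^sub>R gradf x))\<^sup>2"
    by (rule quadratic_upper_bound)
  also have "\<dots> = f x - (norm (gradf x))\<^sup>2 / (2 * L)"
    using L_pos by (simp add: power2_norm_eq_inner[symmetric] power_mult_distrib field_simps power2_eq_square)
  finally show ?thesis
    using L_pos by (simp add: field_simps)
qed

lemma descent_step:
  "f (x - (1 / (2 * L)) *\<^sub>R (gradf x + e))
     \<le> f x - 3 / (8 * L) * (norm (gradf x))\<^sup>2 - 1 / (4 * L) * (gradf x \<bullet> e)
       + 1 / (8 * L) * (norm e)\<^sup>2"
proof -
  let ?h = "(- (1 / (2 * L))) *\<^sub>R (gradf x + e)"
  have norm_h: "(norm ?h)\<^sup>2 =
      (1 / (2 * L))\<^sup>2 * ((norm (gradf x))\<^sup>2 + 2 * (gradf x \<bullet> e) + (norm e)\<^sup>2)"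
    by (simp only: power2_norm_eq_inner inner_scaleR_left inner_scaleR_right inner_add_left
        inner_add_right inner_commute[of e "gradf x"]) (simp add: power2_eq_square algebra_simps)
  have inner_h: "gradf x \<bullet> ?h = - (1 / (2 * L)) * ((norm (gradf x))\<^sup>2 + gradf x \<bullet> e)"
    by (simp only: power2_norm_eq_inner inner_scaleR_right inner_add_right)
  have arith: "- (1 / (2 * L)) * (A + B) + L / 2 * ((1 / (2 * L))\<^sup>2 * (A + 2 * B + C))
      = - 3 / (8 * L) * A - 1 / (4 * L) * B + 1 / (8 * L) * C" for A B C
    using L_pos by (simp add: field_simps power2_eq_square)
  show ?thesis
    using quadratic_upper_bound[of x ?h] arith[of "(norm (gradf x))\<^sup>2" "gradf x \<bullet> e" "(norm e)\<^sup>2"]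
    unfolding norm_h inner_h by simp
qed

lemma continuous_f: "continuous_on UNIV f"
  using gradient unfolding gderiv_def
  by (auto intro!: continuous_at_imp_continuous_on dest: has_derivative_continuous)

lemma continuous_gradf: "continuous_on UNIV gradf"
proof -
  have "L-lipschitz_on UNIV gradf"
    using gradient_Lipschitz L_pos by (intro lipschitz_onI) (auto simp: dist_norm)
  then show ?thesis by (rule lipschitz_on_continuous_on)
qed

lemma measurable_f [measurable]: "f \<in> borel_measurable borel"
  using continuous_f by (rule borel_measurable_continuous_onI)

lemma measurable_gradf [measurable]: "gradf \<in> borel_measurable borel"
  using continuous_gradf by (rule borel_measurable_continuous_onI)

end

section \<open>Integrating out a fresh sample\<close>

text \<open>
  \<open>Z\<close> has law \<open>D\<close> and is independent of \<open>Y\<close>. The predicate \<^const>\<open>prob_space.indep_var\<close> requires both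
  variables to have values of the same type; the equivalent condition on the joint law does not, and it is
  the form in which Fubini's theorem applies.
\<close>

definition fresh_sample ::
  "'w measure \<Rightarrow> 'y measure \<Rightarrow> ('w \<Rightarrow> 'y) \<Rightarrow> 'z measure \<Rightarrow> ('w \<Rightarrow> 'z) \<Rightarrow> bool"
  where "fresh_sample M N Y D Z \<longleftrightarrow> Y \<in> measurable M N \<and> Z \<in> measurable M D \<and>
    distr M (N \<Otimes>\<^sub>M D) (\<lambda>\<omega>. (Y \<omega>, Z \<omega>)) = distr M N Y \<Otimes>\<^sub>M D"

text \<open>
  The known variable \<open>Y\<close> can be frozen while averaging over the fresh sample: as the joint law is a product, this is
  Fubini's theorem transported along \<open>(Y, Z)\<close>. It replaces conditional expectations given \<open>Y\<close>.
\<close>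

lemma (in prob_space) freezing_lemma:
  fixes h :: "'b \<times> 'c \<Rightarrow> 'e::{banach, second_countable_topology}"
  assumes "prob_space D" and fresh: "fresh_sample M N Y D Z"
    and h [measurable]: "h \<in> borel_measurable (N \<Otimes>\<^sub>M D)"
  shows freezing_integrable: "\<lbrakk>\<And>y. y \<in> space N \<Longrightarrow> integrable D (\<lambda>z. h (y, z));
        integrable M (\<lambda>\<omega>. \<integral>z. norm (h (Y \<omega>, z)) \<partial>D)\<rbrakk>
      \<Longrightarrow> integrable M (\<lambda>\<omega>. h (Y \<omega>, Z \<omega>))"
    and freezing_expectation: "integrable M (\<lambda>\<omega>. h (Y \<omega>, Z \<omega>))
      \<Longrightarrow> expectation (\<lambda>\<omega>. h (Y \<omega>, Z \<omega>)) = expectation (\<lambda>\<omega>. \<integral>z. h (Y \<omega>, z) \<partial>D)"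
proof -
  have [measurable]: "random_variable N Y" "random_variable D Z"
    and joint: "distr M N Y \<Otimes>\<^sub>M D = distr M (N \<Otimes>\<^sub>M D) (\<lambda>\<omega>. (Y \<omega>, Z \<omega>))"
    using fresh by (auto simp: fresh_sample_def)
  interpret D: prob_space D by fact
  interpret Y: prob_space "distr M N Y"
    by (rule prob_space_distr) measurable
  interpret YD: pair_sigma_finite "distr M N Y" D ..
  have joint_integrable:
    "integrable (distr M N Y \<Otimes>\<^sub>M D) h \<longleftrightarrow> integrable M (\<lambda>\<omega>. h (Y \<omega>, Z \<omega>))"
    unfolding joint by (rule integrable_distr_eq) measurable
  show "integrable M (\<lambda>\<omega>. h (Y \<omega>, Z \<omega>))"
    if "\<And>y. y \<in> space N \<Longrightarrow> integrable D (\<lambda>z. h (y, z))"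
      and "integrable M (\<lambda>\<omega>. \<integral>z. norm (h (Y \<omega>, z)) \<partial>D)"
    unfolding joint_integrable[symmetric]
  proof (rule YD.Fubini_integrable)
    show "integrable (distr M N Y) (\<lambda>y. \<integral>z. norm (h (y, z)) \<partial>D)"
      using that(2) by (subst integrable_distr_eq) measurable
    show "AE y in distr M N Y. integrable D (\<lambda>z. h (y, z))"
      using that(1) by (intro AE_I2) simp
  qed measurable
  show "expectation (\<lambda>\<omega>. h (Y \<omega>, Z \<omega>)) = expectation (\<lambda>\<omega>. \<integral>z. h (Y \<omega>, z) \<partial>D)"
    if "integrable M (\<lambda>\<omega>. h (Y \<omega>, Z \<omega>))"
  proof -
    have "expectation (\<lambda>\<omega>. h (Y \<omega>, Z \<omega>)) = (\<integral>p. h p \<partial>(distr M N Y \<Otimes>\<^sub>M D))"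
      unfolding joint by (rule integral_distr[symmetric]) measurable
    also have "\<dots> = (\<integral>y. \<integral>z. h (y, z) \<partial>D \<partial>distr M N Y)"
      using that by (intro YD.integral_fst'[symmetric]) (simp add: joint_integrable)
    also have "\<dots> = expectation (\<lambda>\<omega>. \<integral>z. h (Y \<omega>, z) \<partial>D)"
      by (rule integral_distr) measurable
    finally show ?thesis .
  qed
qed

lemma abs_inner_le_sum_squares: "\<bar>u \<bullet> w\<bar> \<le> (norm u)\<^sup>2 + (norm w)\<^sup>2"
proof -
  have "\<bar>u \<bullet> w\<bar> \<le> norm u * norm w"
    by (rule Cauchy_Schwarz_ineq2)
  also have "\<dots> \<le> 2 * norm u * norm w"
    by simp
  also have "\<dots> \<le> (norm u)\<^sup>2 + (norm w)\<^sup>2"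
    by (rule sum_squares_bound)
  finally show ?thesis .
qed

locale stochastic_gradient = prob_space D for D :: "'z measure" +
  fixes G :: "'a::euclidean_space \<Rightarrow> 'z \<Rightarrow> 'a" and gradf :: "'a \<Rightarrow> 'a" and \<sigma> :: real
  assumes measurable_oracle [measurable]: "(\<lambda>(x, z). G x z) \<in> borel_measurable (borel \<Otimes>\<^sub>M D)"
    and measurable_gradient [measurable]: "gradf \<in> borel_measurable borel"
    and integrable_oracle: "integrable D (G x)"
    and unbiased: "(\<integral>z. G x z \<partial>D) = gradf x"
    and integrable_variance: "integrable D (\<lambda>z. (norm (G x z - gradf x))\<^sup>2)"
    and variance_le: "(\<integral>z. (norm (G x z - gradf x))\<^sup>2 \<partial>D) \<le> \<sigma>\<^sup>2"
begin

definition noise :: "'a \<Rightarrow> 'z \<Rightarrow> 'a"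
  where "noise x z = G x z - gradf x"

lemma measurable_noise [measurable (raw)]:
  assumes [measurable]: "X \<in> borel_measurable N" "Z \<in> measurable N D"
  shows "(\<lambda>\<omega>. noise (X \<omega>) (Z \<omega>)) \<in> borel_measurable N"
proof -
  have "(\<lambda>\<omega>. (\<lambda>(x, z). G x z) (X \<omega>, Z \<omega>)) \<in> borel_measurable N"
    by measurable
  then have [measurable]: "(\<lambda>\<omega>. G (X \<omega>) (Z \<omega>)) \<in> borel_measurable N"
    by simp
  show ?thesis unfolding noise_def by measurable
qed

text \<open>
  For each frozen value of the iterate \<open>X (Y \<omega>)\<close> the variance bound of the oracle applies, and it does
  not depend on that value. The variable \<open>Y\<close> stands for everything known before the sample is drawn.
\<close>

lemma noise_second_moment:
  assumes "prob_space M" and fresh: "fresh_sample M N Y D Z"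
    and X [measurable]: "X \<in> borel_measurable N"
  shows "integrable M (\<lambda>\<omega>. (norm (noise (X (Y \<omega>)) (Z \<omega>)))\<^sup>2)"
    and "(\<integral>\<omega>. (norm (noise (X (Y \<omega>)) (Z \<omega>)))\<^sup>2 \<partial>M) \<le> \<sigma>\<^sup>2"
proof -
  interpret M: prob_space M by fact
  have [measurable]: "M.random_variable N Y"
    using fresh by (simp add: fresh_sample_def)
  let ?h = "\<lambda>(y, z). (norm (noise (X y) z))\<^sup>2"
  have h: "?h \<in> borel_measurable (N \<Otimes>\<^sub>M D)"
    by measurable
  have variance: "integrable M (\<lambda>\<omega>. \<integral>z. (norm (noise (X (Y \<omega>)) z))\<^sup>2 \<partial>D)"
    by (rule M.integrable_const_bound[where B = "\<sigma>\<^sup>2"])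
      (auto simp: noise_def variance_le)
  have "integrable M (\<lambda>\<omega>. ?h (Y \<omega>, Z \<omega>))"
    using variance
    by (intro M.freezing_integrable[OF prob_space_axioms fresh h])
      (auto simp: noise_def integrable_variance)
  then show integrable: "integrable M (\<lambda>\<omega>. (norm (noise (X (Y \<omega>)) (Z \<omega>)))\<^sup>2)"
    by simp
  have "(\<integral>\<omega>. (norm (noise (X (Y \<omega>)) (Z \<omega>)))\<^sup>2 \<partial>M)
      = (\<integral>\<omega>. \<integral>z. (norm (noise (X (Y \<omega>)) z))\<^sup>2 \<partial>D \<partial>M)"
    using M.freezing_expectation[OF prob_space_axioms fresh h] integrable by simp
  also have "\<dots> \<le> (\<integral>\<omega>. \<sigma>\<^sup>2 \<partial>M)"
    using variance by (intro integral_mono) (auto simp: noise_def variance_le)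
  finally show "(\<integral>\<omega>. (norm (noise (X (Y \<omega>)) (Z \<omega>)))\<^sup>2 \<partial>M) \<le> \<sigma>\<^sup>2"
    by (simp add: M.prob_space)
qed

text \<open>
  The noise has mean zero for each frozen value of \<open>Y\<close>, hence is orthogonal to every
  square-integrable function \<open>u\<close> of \<open>Y\<close>. Taking for \<open>u\<close> the gradient at the iterate, or the noise of
  another sample, yields both orthogonality relations behind the convergence rate.
\<close>

lemma noise_orthogonal:
  assumes "prob_space M" and fresh: "fresh_sample M N Y D Z"
    and [measurable]: "X \<in> borel_measurable N" "u \<in> borel_measurable N"
    and u: "integrable M (\<lambda>\<omega>. (norm (u (Y \<omega>)))\<^sup>2)"
  shows "integrable M (\<lambda>\<omega>. u (Y \<omega>) \<bullet> noise (X (Y \<omega>)) (Z \<omega>))"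
    and "(\<integral>\<omega>. u (Y \<omega>) \<bullet> noise (X (Y \<omega>)) (Z \<omega>) \<partial>M) = 0"
proof -
  interpret M: prob_space M by fact
  have [measurable]: "M.random_variable N Y" "M.random_variable D Z"
    using fresh by (simp_all add: fresh_sample_def)
  let ?h = "\<lambda>(y, z). u y \<bullet> noise (X y) z"
  have h: "?h \<in> borel_measurable (N \<Otimes>\<^sub>M D)"
    by measurable
  have "integrable M (\<lambda>\<omega>. (norm (u (Y \<omega>)))\<^sup>2 + (norm (noise (X (Y \<omega>)) (Z \<omega>)))\<^sup>2)"
    using u noise_second_moment(1)[OF assms(1-3)] by simp
  then show integrable: "integrable M (\<lambda>\<omega>. u (Y \<omega>) \<bullet> noise (X (Y \<omega>)) (Z \<omega>))"
    by (rule Bochner_Integration.integrable_bound)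
      (auto intro!: abs_inner_le_sum_squares)
  have "(\<integral>z. noise x z \<partial>D) = 0" for x
    using integrable_oracle unbiased by (simp add: noise_def prob_space)
  moreover have "integrable D (noise x)" for x
    using integrable_oracle unfolding noise_def by simp
  ultimately have zero_mean: "(\<integral>z. w \<bullet> noise x z \<partial>D) = 0" for w x
    by simp
  show "(\<integral>\<omega>. u (Y \<omega>) \<bullet> noise (X (Y \<omega>)) (Z \<omega>) \<partial>M) = 0"
    using M.freezing_expectation[OF prob_space_axioms fresh h] integrable zero_mean by simp
qed

end

section \<open>Iterates as functions of past samples\<close>

text \<open>
  The two sides may live on different probability spaces. This allows the iterates to be regarded as
  functions on the space of sample families.
\<close>

lemma rennala_iterate_cong:
  assumes "\<And>j s. j < k \<Longrightarrow> s \<in> {1..S} \<Longrightarrow> \<xi> j s \<omega> = \<xi>' j s \<omega>'"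
  shows "rennala_iterate G \<gamma> S x0 \<xi> k \<omega> = rennala_iterate G \<gamma> S x0 \<xi>' k \<omega>'"
  using assms by (induction k) (auto simp: Let_def intro!: sum.cong)

lemma (in stochastic_gradient) measurable_rennala_iterate:
  assumes "\<And>j s. j < k \<Longrightarrow> s \<in> {1..S} \<Longrightarrow> \<xi> j s \<in> measurable N D"
  shows "rennala_iterate G \<gamma> S x0 \<xi> k \<in> borel_measurable N"
  using assms
proof (induction k)
  case 0
  have "rennala_iterate G \<gamma> S x0 \<xi> 0 = (\<lambda>_. x0)"
    by (rule ext) simp
  then show ?case by simp
next
  case (Suc k)
  then have [measurable]: "rennala_iterate G \<gamma> S x0 \<xi> k \<in> borel_measurable N"
    by simp
  have "(\<lambda>\<omega>. (\<lambda>(x, z). G x z) (rennala_iterate G \<gamma> S x0 \<xi> k \<omega>, \<xi> k s \<omega>)) \<in> borel_measurable N"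
    if "s \<in> {1..S}" for s
  proof -
    have [measurable]: "\<xi> k s \<in> measurable N D"
      using Suc.prems that by simp
    show ?thesis by measurable
  qed
  then have [measurable]: "(\<lambda>\<omega>. \<Sum>s\<in>{1..S}. G (rennala_iterate G \<gamma> S x0 \<xi> k \<omega>) (\<xi> k s \<omega>))
      \<in> borel_measurable N"
    by (intro borel_measurable_sum) simp
  have "rennala_iterate G \<gamma> S x0 \<xi> (Suc k) = (\<lambda>\<omega>. rennala_iterate G \<gamma> S x0 \<xi> k \<omega> -
      \<gamma> *\<^sub>R ((1 / real S) *\<^sub>R (\<Sum>s\<in>{1..S}. G (rennala_iterate G \<gamma> S x0 \<xi> k \<omega>) (\<xi> k s \<omega>))))"
    by (rule ext) (simp add: Let_def)
  also have "\<dots> \<in> borel_measurable N"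
    by measurable
  finally show ?case .
qed

locale rennala_run =
  smooth_function f gradf L fstar + stochastic_gradient D G gradf \<sigma> + M: prob_space M
  for f :: "'a::euclidean_space \<Rightarrow> real" and gradf L fstar and D :: "'z measure" and G \<sigma>
    and M :: "'w measure" +
  fixes \<xi> :: "nat \<Rightarrow> nat \<Rightarrow> 'w \<Rightarrow> 'z" and S :: nat and x0 :: 'a
  assumes batch_nonempty: "S \<ge> 1"
    and sample_distr: "s \<in> {1..S} \<Longrightarrow> distr M D (\<xi> k s) = D"
    and samples_indep: "M.indep_vars (\<lambda>_. D) (\<lambda>(k, s). \<xi> k s) (UNIV \<times> {1..S})"
begin

abbreviation iterate :: "nat \<Rightarrow> 'w \<Rightarrow> 'a"
  where "iterate \<equiv> rennala_iterate G (1 / (2 * L)) S x0 \<xi>"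

definition samples :: "(nat \<times> nat) set \<Rightarrow> 'w \<Rightarrow> nat \<times> nat \<Rightarrow> 'z"
  where "samples J \<omega> = restrict (\<lambda>p. (case p of (k, s) \<Rightarrow> \<xi> k s) \<omega>) J"

text \<open>
  Running the recursion with the coordinate projections as samples expresses the iterate as a function of
  the samples, on which it depends only through the first \<open>k\<close> batches.
\<close>

definition iterate_of_samples :: "nat \<Rightarrow> (nat \<times> nat \<Rightarrow> 'z) \<Rightarrow> 'a"
  where "iterate_of_samples = rennala_iterate G (1 / (2 * L)) S x0 (\<lambda>k s y. y (k, s))"

definition batch_noise :: "nat \<Rightarrow> 'w \<Rightarrow> 'a"
  where "batch_noise k \<omega> = (1 / real S) *\<^sub>R (\<Sum>s\<in>{1..S}. noise (iterate k \<omega>) (\<xi> k s \<omega>))"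

lemma measurable_sample: "s \<in> {1..S} \<Longrightarrow> M.random_variable D (\<xi> k s)"
  using samples_indep unfolding M.indep_vars_def by force

lemma measurable_iterate [measurable]: "iterate k \<in> borel_measurable M"
  by (rule measurable_rennala_iterate) (rule measurable_sample)

lemma iterate_eq_of_samples:
  assumes "{..<k} \<times> {1..S} \<subseteq> J"
  shows "iterate k \<omega> = iterate_of_samples k (samples J \<omega>)"
  unfolding iterate_of_samples_def
proof (rule rennala_iterate_cong)
  fix j s assume "j < k" "s \<in> {1..S}"
  then have "(j, s) \<in> J" using assms by blast
  then show "\<xi> j s \<omega> = samples J \<omega> (j, s)" by (simp add: samples_def)
qed

lemma measurable_iterate_of_samples:
  "{..<k} \<times> {1..S} \<subseteq> J \<Longrightarrow> iterate_of_samples k \<in> borel_measurable (PiM J (\<lambda>_. D))"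
  unfolding iterate_of_samples_def
  by (rule measurable_rennala_iterate, rule measurable_component_singleton) auto

text \<open>
  A sample outside \<open>J\<close> is independent of the family indexed by \<open>J\<close>. The independence of restricted families
  gives this for the one-element family of the sample; evaluating that family at its only index turns it
  into the sample itself.
\<close>

lemma fresh_sample_of_past:
  assumes "J \<subseteq> UNIV \<times> {1..S}" "s \<in> {1..S}" "(k, s) \<notin> J"
  shows "fresh_sample M (PiM J (\<lambda>_. D)) (samples J) D (\<xi> k s)"
proof -
  let ?N = "PiM J (\<lambda>_. D)" and ?P = "PiM {(k, s)} (\<lambda>_. D)"
  have indep: "M.indep_var ?N (samples J) ?P (samples {(k, s)})"
    unfolding samples_def using assms by (intro M.indep_var_restrict[OF samples_indep]) auto
  then have [measurable]: "M.random_variable ?N (samples J)"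
      "M.random_variable ?P (samples {(k, s)})"
    and joint: "distr M ?N (samples J) \<Otimes>\<^sub>M distr M ?P (samples {(k, s)})
      = distr M (?N \<Otimes>\<^sub>M ?P) (\<lambda>\<omega>. (samples J \<omega>, samples {(k, s)} \<omega>))"
    unfolding M.indep_var_distribution_eq by blast+
  have [measurable]: "(\<lambda>y. y (k, s)) \<in> measurable ?P D"
    by (rule measurable_component_singleton) simp
  have \<xi>: "\<xi> k s \<omega> = samples {(k, s)} \<omega> (k, s)" for \<omega>
    by (simp add: samples_def)
  have D_eq: "D = distr (distr M ?P (samples {(k, s)})) D (\<lambda>y. y (k, s))"
    using sample_distr[OF assms(2), of k] by (subst distr_distr) (simp_all add: o_def \<xi>[symmetric])
  have "distr M ?N (samples J) \<Otimes>\<^sub>M D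
      = distr (distr M ?N (samples J)) ?N (\<lambda>y. y)
        \<Otimes>\<^sub>M distr (distr M ?P (samples {(k, s)})) D (\<lambda>y. y (k, s))"
    by (simp add: distr_id2 D_eq[symmetric])
  also have "\<dots> = distr (distr M ?N (samples J) \<Otimes>\<^sub>M distr M ?P (samples {(k, s)}))
      (?N \<Otimes>\<^sub>M D) (\<lambda>(x, y). (x, y (k, s)))"
    by (rule pair_measure_distr) (simp_all add: D_eq[symmetric] sigma_finite_measure_axioms)
  also have "\<dots> = distr M (?N \<Otimes>\<^sub>M D) (\<lambda>\<omega>. (samples J \<omega>, \<xi> k s \<omega>))"
    unfolding joint by (subst distr_distr) (simp_all add: o_def \<xi>)
  finally show ?thesis
    using measurable_sample[OF assms(2)] by (simp add: fresh_sample_def)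
qed

section \<open>Noise of a batch\<close>

context
  fixes k s :: nat assumes s: "s \<in> {1..S}"
begin

lemma sample_noise_second_moment:
  "integrable M (\<lambda>\<omega>. (norm (noise (iterate k \<omega>) (\<xi> k s \<omega>)))\<^sup>2)"
  "(\<integral>\<omega>. (norm (noise (iterate k \<omega>) (\<xi> k s \<omega>)))\<^sup>2 \<partial>M) \<le> \<sigma>\<^sup>2"
proof -
  let ?J = "{..<k} \<times> {1..S}"
  have fresh: "fresh_sample M (PiM ?J (\<lambda>_. D)) (samples ?J) D (\<xi> k s)"
    using s by (intro fresh_sample_of_past) auto
  note noise_second_moment[OF M.prob_space_axioms fresh
      measurable_iterate_of_samples[OF subset_refl]]
  then show "integrable M (\<lambda>\<omega>. (norm (noise (iterate k \<omega>) (\<xi> k s \<omega>)))\<^sup>2)"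
    "(\<integral>\<omega>. (norm (noise (iterate k \<omega>) (\<xi> k s \<omega>)))\<^sup>2 \<partial>M) \<le> \<sigma>\<^sup>2"
    unfolding iterate_eq_of_samples[OF subset_refl, symmetric] .
qed

lemma sample_noise_orthogonal_to_gradient:
  assumes int: "integrable M (\<lambda>\<omega>. (norm (gradf (iterate k \<omega>)))\<^sup>2)"
  shows "integrable M (\<lambda>\<omega>. gradf (iterate k \<omega>) \<bullet> noise (iterate k \<omega>) (\<xi> k s \<omega>))"
    "(\<integral>\<omega>. gradf (iterate k \<omega>) \<bullet> noise (iterate k \<omega>) (\<xi> k s \<omega>) \<partial>M) = 0"
proof -
  let ?J = "{..<k} \<times> {1..S}"
  have fresh: "fresh_sample M (PiM ?J (\<lambda>_. D)) (samples ?J) D (\<xi> k s)"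
    using s by (intro fresh_sample_of_past) auto
  note iter = iterate_eq_of_samples[where k = k, OF subset_refl]
  note X = measurable_iterate_of_samples[where k = k, OF subset_refl]
  have u: "(\<lambda>y. gradf (iterate_of_samples k y)) \<in> borel_measurable (PiM ?J (\<lambda>_. D))"
    using X by measurable
  note noise_orthogonal[where u = "\<lambda>y. gradf (iterate_of_samples k y)", OF M.prob_space_axioms fresh X u
      int[unfolded iter]]
  then show "integrable M (\<lambda>\<omega>. gradf (iterate k \<omega>) \<bullet> noise (iterate k \<omega>) (\<xi> k s \<omega>))"
    "(\<integral>\<omega>. gradf (iterate k \<omega>) \<bullet> noise (iterate k \<omega>) (\<xi> k s \<omega>) \<partial>M) = 0"
    unfolding iter[symmetric] .
qed

end

text \<open>
  Relative to \<open>s'\<close>, the sample \<open>s\<close> of the same batch counts as past: the known family is that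
  of all previous batches with \<open>(k, s)\<close> added.
\<close>

lemma sample_noises_orthogonal:
  assumes s: "s \<in> {1..S}" and s': "s' \<in> {1..S}" and "s \<noteq> s'"
  shows "integrable M (\<lambda>\<omega>. noise (iterate k \<omega>) (\<xi> k s \<omega>) \<bullet> noise (iterate k \<omega>) (\<xi> k s' \<omega>))"
    "(\<integral>\<omega>. noise (iterate k \<omega>) (\<xi> k s \<omega>) \<bullet> noise (iterate k \<omega>) (\<xi> k s' \<omega>) \<partial>M) = 0"
proof -
  let ?J = "insert (k, s) ({..<k} \<times> {1..S})"
  have fresh: "fresh_sample M (PiM ?J (\<lambda>_. D)) (samples ?J) D (\<xi> k s')"
    using assms by (intro fresh_sample_of_past) auto
  have iter: "iterate k \<omega> = iterate_of_samples k (samples ?J \<omega>)" for \<omega>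
    by (rule iterate_eq_of_samples) auto
  have \<xi>: "\<xi> k s \<omega> = samples ?J \<omega> (k, s)" for \<omega>
    by (simp add: samples_def)
  have X: "iterate_of_samples k \<in> borel_measurable (PiM ?J (\<lambda>_. D))"
    by (rule measurable_iterate_of_samples) auto
  have u: "(\<lambda>y. noise (iterate_of_samples k y) (y (k, s))) \<in> borel_measurable (PiM ?J (\<lambda>_. D))"
    using X by measurable
  have int: "integrable M (\<lambda>\<omega>. (norm (noise (iterate_of_samples k (samples ?J \<omega>)) (samples ?J \<omega> (k, s))))\<^sup>2)"
    using sample_noise_second_moment(1)[OF s, of k] unfolding iter \<xi> .
  show "integrable M (\<lambda>\<omega>. noise (iterate k \<omega>) (\<xi> k s \<omega>) \<bullet> noise (iterate k \<omega>) (\<xi> k s' \<omega>))"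
    "(\<integral>\<omega>. noise (iterate k \<omega>) (\<xi> k s \<omega>) \<bullet> noise (iterate k \<omega>) (\<xi> k s' \<omega>) \<partial>M) = 0"
    using noise_orthogonal[where u = "\<lambda>y. noise (iterate_of_samples k y) (y (k, s))",
        OF M.prob_space_axioms fresh X u int]
    unfolding iter \<xi> .
qed

text \<open>
  In the expansion of the squared norm of the average, the \<open>S^2\<close> inner products carry the factor \<open>1/S^2\<close>, and
  only the \<open>S\<close> diagonal ones can have a non-zero expectation. This is how a batch divides the variance by its size.
\<close>

lemma batch_noise_second_moment:
  "integrable M (\<lambda>\<omega>. (norm (batch_noise k \<omega>))\<^sup>2)"
  "(\<integral>\<omega>. (norm (batch_noise k \<omega>))\<^sup>2 \<partial>M) \<le> \<sigma>\<^sup>2 / real S"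
proof -
  define e where "e s \<omega> = noise (iterate k \<omega>) (\<xi> k s \<omega>)" for s \<omega>
  have expand: "(norm (batch_noise k \<omega>))\<^sup>2
      = (1 / real S)\<^sup>2 * (\<Sum>s\<in>{1..S}. \<Sum>s'\<in>{1..S}. e s \<omega> \<bullet> e s' \<omega>)" for \<omega>
  proof -
    have "(norm (batch_noise k \<omega>))\<^sup>2
        = (1 / real S)\<^sup>2 * ((\<Sum>s\<in>{1..S}. e s \<omega>) \<bullet> (\<Sum>s\<in>{1..S}. e s \<omega>))"
      unfolding batch_noise_def e_def norm_scaleR power_mult_distrib power2_norm_eq_inner by simp
    then show ?thesis
      unfolding inner_sum_left unfolding inner_sum_right .
  qed
  have int: "integrable M (\<lambda>\<omega>. e s \<omega> \<bullet> e s' \<omega>)" if "s \<in> {1..S}" "s' \<in> {1..S}" for s s'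
    using sample_noise_second_moment(1)[OF that(1), of k] sample_noises_orthogonal(1)[OF that, of k]
    by (cases "s = s'") (auto simp: e_def power2_norm_eq_inner)
  show "integrable M (\<lambda>\<omega>. (norm (batch_noise k \<omega>))\<^sup>2)"
    unfolding expand using int by (intro integrable_mult_right Bochner_Integration.integrable_sum)
  have diag: "(\<integral>\<omega>. e s \<omega> \<bullet> e s' \<omega> \<partial>M) \<le> (if s = s' then \<sigma>\<^sup>2 else 0)"
    if "s \<in> {1..S}" "s' \<in> {1..S}" for s s'
    using sample_noise_second_moment(2)[OF that(1), of k] sample_noises_orthogonal(2)[OF that, of k]
    by (auto simp: e_def power2_norm_eq_inner)
  have "(\<integral>\<omega>. (norm (batch_noise k \<omega>))\<^sup>2 \<partial>M)
      = (1 / real S)\<^sup>2 * (\<Sum>s\<in>{1..S}. \<Sum>s'\<in>{1..S}. \<integral>\<omega>. e s \<omega> \<bullet> e s' \<omega> \<partial>M)"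
    unfolding expand using int
    by (subst integral_mult_right_zero, subst Bochner_Integration.integral_sum)
      (auto intro!: sum.cong Bochner_Integration.integral_sum Bochner_Integration.integrable_sum)
  also have "\<dots> \<le> (1 / real S)\<^sup>2 * (\<Sum>s\<in>{1..S}. \<Sum>s'\<in>{1..S}. if s = s' then \<sigma>\<^sup>2 else 0)"
    using diag by (intro mult_left_mono sum_mono) auto
  also have "\<dots> = \<sigma>\<^sup>2 / real S"
    using batch_nonempty by (simp add: power2_eq_square field_simps)
  finally show "(\<integral>\<omega>. (norm (batch_noise k \<omega>))\<^sup>2 \<partial>M) \<le> \<sigma>\<^sup>2 / real S" .
qed

lemma batch_noise_orthogonal_to_gradient:
  assumes "integrable M (\<lambda>\<omega>. (norm (gradf (iterate k \<omega>)))\<^sup>2)"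
  shows "integrable M (\<lambda>\<omega>. gradf (iterate k \<omega>) \<bullet> batch_noise k \<omega>)"
    "(\<integral>\<omega>. gradf (iterate k \<omega>) \<bullet> batch_noise k \<omega> \<partial>M) = 0"
proof -
  note orth = sample_noise_orthogonal_to_gradient[OF _ assms]
  have expand: "gradf (iterate k \<omega>) \<bullet> batch_noise k \<omega> =
      (1 / real S) * (\<Sum>s\<in>{1..S}. gradf (iterate k \<omega>) \<bullet> noise (iterate k \<omega>) (\<xi> k s \<omega>))" for \<omega>
    by (simp add: batch_noise_def inner_sum_right)
  show "integrable M (\<lambda>\<omega>. gradf (iterate k \<omega>) \<bullet> batch_noise k \<omega>)"
    unfolding expand using orth(1)
    by (intro integrable_mult_right Bochner_Integration.integrable_sum)
  show "(\<integral>\<omega>. gradf (iterate k \<omega>) \<bullet> batch_noise k \<omega> \<partial>M) = 0"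
    unfolding expand using orth
    by (subst integral_mult_right_zero, subst Bochner_Integration.integral_sum) auto
qed

section \<open>Convergence rate\<close>

lemma iterate_Suc:
  "iterate (Suc k) \<omega> = iterate k \<omega> - (1 / (2 * L)) *\<^sub>R (gradf (iterate k \<omega>) + batch_noise k \<omega>)"
proof -
  have "(1 / real S) *\<^sub>R (\<Sum>s\<in>{1..S}. G (iterate k \<omega>) (\<xi> k s \<omega>))
      = gradf (iterate k \<omega>) + batch_noise k \<omega>"
    using batch_nonempty
    by (simp add: batch_noise_def noise_def sum_subtractf scaleR_diff_right)
       (simp add: sum_constant_scaleR)
  then show ?thesis by (simp only: rennala_iterate.simps Let_def)
qed

lemma integrable_gradient_sq:
  assumes "integrable M (\<lambda>\<omega>. f (iterate k \<omega>))"
  shows "integrable M (\<lambda>\<omega>. (norm (gradf (iterate k \<omega>)))\<^sup>2)"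
proof (rule Bochner_Integration.integrable_bound)
  show "integrable M (\<lambda>\<omega>. 2 * L * (f (iterate k \<omega>) - fstar))"
    using assms by simp
  show "AE \<omega> in M. norm ((norm (gradf (iterate k \<omega>)))\<^sup>2) \<le> norm (2 * L * (f (iterate k \<omega>) - fstar))"
    by (auto intro: order_trans[OF norm_gradient_sq_le abs_ge_self])
qed measurable

text \<open>
  Integrability of \<open>f\<close> passes from one iterate to the next, because the new value lies between the constant
  \<open>fstar\<close> and the integrable upper bound \<open>B\<close> given by the descent step.
\<close>

lemma expected_descent:
  assumes int_f: "integrable M (\<lambda>\<omega>. f (iterate k \<omega>))"
  shows "integrable M (\<lambda>\<omega>. f (iterate (Suc k) \<omega>))"
    and "(\<integral>\<omega>. f (iterate (Suc k) \<omega>) \<partial>M) \<le> (\<integral>\<omega>. f (iterate k \<omega>) \<partial>M)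
      - 3 / (8 * L) * (\<integral>\<omega>. (norm (gradf (iterate k \<omega>)))\<^sup>2 \<partial>M) + \<sigma>\<^sup>2 / (8 * L * real S)"
proof -
  define B where "B \<omega> = f (iterate k \<omega>) - 3 / (8 * L) * (norm (gradf (iterate k \<omega>)))\<^sup>2
      - 1 / (4 * L) * (gradf (iterate k \<omega>) \<bullet> batch_noise k \<omega>)
      + 1 / (8 * L) * (norm (batch_noise k \<omega>))\<^sup>2" for \<omega>
  note int_g = integrable_gradient_sq[OF int_f]
  note orth = batch_noise_orthogonal_to_gradient[OF int_g]
  note var = batch_noise_second_moment[of k]
  have int_B: "integrable M B"
    unfolding B_def using int_f int_g orth(1) var(1) by simp
  have le_B: "f (iterate (Suc k) \<omega>) \<le> B \<omega>" for \<omega>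
    unfolding iterate_Suc B_def by (rule descent_step)
  show int_Suc: "integrable M (\<lambda>\<omega>. f (iterate (Suc k) \<omega>))"
  proof (rule Bochner_Integration.integrable_bound)
    show "integrable M (\<lambda>\<omega>. \<bar>B \<omega>\<bar> + \<bar>fstar\<bar>)"
      using int_B by simp
    show "AE \<omega> in M. norm (f (iterate (Suc k) \<omega>)) \<le> norm (\<bar>B \<omega>\<bar> + \<bar>fstar\<bar>)"
    proof (rule AE_I2)
      fix \<omega>
      show "norm (f (iterate (Suc k) \<omega>)) \<le> norm (\<bar>B \<omega>\<bar> + \<bar>fstar\<bar>)"
        using le_B[of \<omega>] bounded_below[of "iterate (Suc k) \<omega>"] unfolding real_norm_def by linarith
    qed
  qed measurable
  have "(\<integral>\<omega>. f (iterate (Suc k) \<omega>) \<partial>M) \<le> (\<integral>\<omega>. B \<omega> \<partial>M)"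
    using int_Suc int_B le_B by (intro integral_mono)
  also have "\<dots> = (\<integral>\<omega>. f (iterate k \<omega>) \<partial>M)
      - 3 / (8 * L) * (\<integral>\<omega>. (norm (gradf (iterate k \<omega>)))\<^sup>2 \<partial>M)
      + 1 / (8 * L) * (\<integral>\<omega>. (norm (batch_noise k \<omega>))\<^sup>2 \<partial>M)"
    unfolding B_def using int_f int_g orth var(1) by simp
  also have "1 / (8 * L) * (\<integral>\<omega>. (norm (batch_noise k \<omega>))\<^sup>2 \<partial>M) \<le> 1 / (8 * L) * (\<sigma>\<^sup>2 / real S)"
    using var(2) L_pos by (intro mult_left_mono) auto
  finally show "(\<integral>\<omega>. f (iterate (Suc k) \<omega>) \<partial>M) \<le> (\<integral>\<omega>. f (iterate k \<omega>) \<partial>M)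
      - 3 / (8 * L) * (\<integral>\<omega>. (norm (gradf (iterate k \<omega>)))\<^sup>2 \<partial>M) + \<sigma>\<^sup>2 / (8 * L * real S)"
    by simp
qed

lemma integrable_f_iterate: "integrable M (\<lambda>\<omega>. f (iterate k \<omega>))"
  by (induction k) (simp, rule expected_descent(1))

lemma sum_expected_gradient_sq_le:
  "3 / (8 * L) * (\<Sum>k<K. \<integral>\<omega>. (norm (gradf (iterate k \<omega>)))\<^sup>2 \<partial>M)
     \<le> f x0 - fstar + real K * (\<sigma>\<^sup>2 / (8 * L * real S))"
proof -
  have "3 / (8 * L) * (\<Sum>k<K. \<integral>\<omega>. (norm (gradf (iterate k \<omega>)))\<^sup>2 \<partial>M)
      \<le> f x0 - (\<integral>\<omega>. f (iterate K \<omega>) \<partial>M) + real K * (\<sigma>\<^sup>2 / (8 * L * real S))"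
  proof (induction K)
    case 0
    then show ?case by (simp add: M.prob_space)
  next
    case (Suc K)
    with expected_descent(2)[OF integrable_f_iterate, of K] show ?case
      unfolding sum.lessThan_Suc of_nat_Suc distrib_left distrib_right by linarith
  qed
  moreover have "(\<integral>\<omega>. fstar \<partial>M) \<le> (\<integral>\<omega>. f (iterate K \<omega>) \<partial>M)"
    using integrable_f_iterate bounded_below by (intro integral_mono) auto
  ultimately show ?thesis by (simp add: M.prob_space)
qed

lemma average_gradient_sq_le:
  assumes "K \<ge> 1"
  shows "(1 / real K) * (\<Sum>k<K. \<integral>\<omega>. (norm (gradf (iterate k \<omega>)))\<^sup>2 \<partial>M)
    \<le> 8 * L * (f x0 - fstar) / (3 * real K) + \<sigma>\<^sup>2 / (3 * real S)"
proof -
  have "8 * L / (3 * real K) * (3 / (8 * L) * (\<Sum>k<K. \<integral>\<omega>. (norm (gradf (iterate k \<omega>)))\<^sup>2 \<partial>M))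
      \<le> 8 * L / (3 * real K) * (f x0 - fstar + real K * (\<sigma>\<^sup>2 / (8 * L * real S)))"
    using sum_expected_gradient_sq_le L_pos by (intro mult_left_mono) auto
  then show ?thesis
    using L_pos assms batch_nonempty by (simp add: distrib_left)
qed

end

theorem theorem5p3:
  fixes f :: "real ^ 'd \<Rightarrow> real" and gradf :: "real ^ 'd \<Rightarrow> real ^ 'd"
    and L fstar \<sigma> \<epsilon> \<gamma> \<Delta> :: real and x0 :: "real ^ 'd"
    and D :: "'z measure" and G :: "real ^ 'd \<Rightarrow> 'z \<Rightarrow> real ^ 'd"
    and n S K :: nat and v :: "nat \<Rightarrow> real \<Rightarrow> real"
    and M :: "'w measure" and \<xi> :: "nat \<Rightarrow> nat \<Rightarrow> 'w \<Rightarrow> 'z"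
    and a :: "nat \<Rightarrow> nat \<Rightarrow> nat \<times> nat" and T :: "nat \<Rightarrow> ereal"
  defines "\<gamma> \<equiv> 1 / (2 * L)"
    and "S \<equiv> nat (max \<lceil>\<sigma>\<^sup>2 / \<epsilon>\<rceil> 1)"
    and "\<Delta> \<equiv> f x0 - fstar"
    and "K \<equiv> nat \<lceil>24 * L * \<Delta> / \<epsilon>\<rceil>"
  assumes gradf: "\<And>x. GDERIV f x :> gradf x"
    and L_pos: "L > 0"
    and smooth: "\<And>x y. norm (gradf x - gradf y) \<le> L * norm (x - y)"
    and lower: "\<And>x. fstar \<le> f x"
    and eps: "\<epsilon> > 0"
    and D: "prob_space D"
    and G_meas: "(\<lambda>(x, z). G x z) \<in> borel_measurable (borel \<Otimes>\<^sub>M D)"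
    and G_int: "\<And>x. integrable D (G x)"
    and G_unbiased: "\<And>x. (\<integral>z. G x z \<partial>D) = gradf x"
    and G_var_int: "\<And>x. integrable D (\<lambda>z. (norm (G x z - gradf x))\<^sup>2)"
    and G_var: "\<And>x. (\<integral>z. (norm (G x z - gradf x))\<^sup>2 \<partial>D) \<le> \<sigma>\<^sup>2"
    and v_nonneg: "\<And>i t. i < n \<Longrightarrow> 0 \<le> t \<Longrightarrow> 0 \<le> v i t"
    and v_cont_ae: "\<And>i. i < n \<Longrightarrow>
          AE t in lebesgue_on {0..}. continuous (at t within {0..}) (v i)"
    and v_integrable: "\<And>i t. i < n \<Longrightarrow> 0 \<le> t \<Longrightarrow> v i integrable_on {0..t}"
    and M: "prob_space M"
    and xi_distr: "\<And>k s. s \<in> {1..S} \<Longrightarrow> distr M D (\<xi> k s) = D"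
    and xi_indep: "prob_space.indep_vars M (\<lambda>_. D) (\<lambda>(k, s). \<xi> k s) (UNIV \<times> {1..S})"
    and timing: "rennala_timing n v S a T"
  shows "T K \<le> tbar n v S K \<and>
    (K \<ge> 1 \<longrightarrow>
      (\<forall>k<K. integrable M (\<lambda>\<omega>. (norm (gradf (rennala_iterate G \<gamma> S x0 \<xi> k \<omega>)))\<^sup>2)) \<and>
      (1 / real K) *
        (\<Sum>k<K. \<integral>\<omega>. (norm (gradf (rennala_iterate G \<gamma> S x0 \<xi> k \<omega>)))\<^sup>2 \<partial>M) \<le> \<epsilon>)"
proof -
  have S_pos: "S \<ge> 1"
    unfolding S_def by linarith
  have "\<sigma>\<^sup>2 / \<epsilon> \<le> real S"
    unfolding S_def by linarith
  then have S_ge: "\<sigma>\<^sup>2 / real S \<le> \<epsilon>"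
    using S_pos eps by (simp add: field_simps)
  have K_ge: "24 * L * \<Delta> \<le> real K * \<epsilon>"
    using real_nat_ceiling_ge[of "24 * L * \<Delta> / \<epsilon>"] eps unfolding K_def by (simp add: field_simps)
  interpret smooth_function f gradf L fstar
    using gradf L_pos smooth lower by unfold_locales
  interpret stochastic_gradient D G gradf \<sigma>
    using D G_meas measurable_gradf G_int G_unbiased G_var_int G_var
    by (intro stochastic_gradient.intro stochastic_gradient_axioms.intro)
  interpret rennala_run f gradf L fstar D G \<sigma> M \<xi> S x0
    using M S_pos xi_distr xi_indep
    by (intro rennala_run.intro rennala_run_axioms.intro
        smooth_function_axioms stochastic_gradient_axioms)
  have "T K \<le> tbar n v S K"
    using rennala_time_le_tbar[OF v_nonneg v_integrable timing S_pos] by blast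
  moreover have "integrable M (\<lambda>\<omega>. (norm (gradf (iterate k \<omega>)))\<^sup>2)" for k
    by (rule integrable_gradient_sq[OF integrable_f_iterate])
  moreover have "(1 / real K) * (\<Sum>k<K. \<integral>\<omega>. (norm (gradf (iterate k \<omega>)))\<^sup>2 \<partial>M) \<le> \<epsilon>"
    if "K \<ge> 1"
  proof -
    note average_gradient_sq_le[OF that]
    \<comment> \<open>As \<open>24 L \<Delta> \<le> K \<epsilon>\<close>, the first term \<open>8 L \<Delta> / (3 K)\<close> is a ninth of \<open>24 L \<Delta> / K\<close>.\<close>
    also have "8 * L * (f x0 - fstar) / (3 * real K) \<le> \<epsilon> / 9"
      using K_ge that by (simp add: \<Delta>_def field_simps)
    also have "\<sigma>\<^sup>2 / (3 * real S) \<le> \<epsilon> / 3"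
      using S_ge by simp
    also have "\<epsilon> / 9 + \<epsilon> / 3 \<le> \<epsilon>"
      using eps by simp
    finally show ?thesis by simp
  qed
  ultimately show ?thesis
    unfolding \<gamma>_def by blast
qed

end
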